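(* Let $k\geq 2$ and $n\geq 5$. Then $\gamma_{\times k}(K(n,2))=k+3$ if and only if $n=2k+3$.
   Context: The Kneser graph $K(n,2)$ has as vertices the $2$-subsets of $[n]=\{1,\dots,n\}$, two vertices adjacent iff disjoint. For a vertex $v$, $N[v]$ is its closed neighbourhood. A set $D$ of vertices is a $k$-tuple dominating set if $|N[v]\cap D|\geq k$ for every vertex $v$; $\gamma_{\times k}(K(n,2))$ is the minimum cardinality of such a set (defined when $k\leq\binom{n-2}{2}+1$). *)

theory Defs
  imports Main "HOL-Library.Extended_Nat"
begin

text \<open>A simple graph is given by a vertex set \<open>V\<close> and an adjacency relation \<open>adj\<close> that is
  symmetric and irreflexive on \<open>V\<close>.\<close>

definition closed_nbhd :: "'a set \<Rightarrow> ('a \<Rightarrow> 'a \<Rightarrow> bool) \<Rightarrow> 'a \<Rightarrow> 'a set" where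
  "closed_nbhd V adj v = insert v {u \<in> V. adj v u}"

definition ktuple_dominating ::
    "'a set \<Rightarrow> ('a \<Rightarrow> 'a \<Rightarrow> bool) \<Rightarrow> nat \<Rightarrow> 'a set \<Rightarrow> bool" where
  "ktuple_dominating V adj k D \<longleftrightarrow>
     D \<subseteq> V \<and> (\<forall>v \<in> V. k \<le> card (closed_nbhd V adj v \<inter> D))"

text \<open>Meant for finite \<open>V\<close>. Then the infimum is a minimum whenever a \<open>k\<close>-tuple dominating set
  exists (see \<open>ktuple_dom_number_eq_enat_iff\<close>); otherwise it is \<open>\<infinity>\<close>, which stands for
  ``undefined'' and differs from every natural number.\<close>

definition ktuple_dom_number :: "'a set \<Rightarrow> ('a \<Rightarrow> 'a \<Rightarrow> bool) \<Rightarrow> nat \<Rightarrow> enat" where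
  "ktuple_dom_number V adj k = (INF D \<in> {D. ktuple_dominating V adj k D}. enat (card D))"

lemma ktuple_dom_number_eq_enat_iff:
  "ktuple_dom_number V adj k = enat m \<longleftrightarrow>
     (\<exists>D. ktuple_dominating V adj k D \<and> card D = m) \<and>
     (\<forall>D. ktuple_dominating V adj k D \<longrightarrow> m \<le> card D)"
    (is "?L = enat m \<longleftrightarrow> ?R")
proof
  let ?S = "(\<lambda>D. enat (card D)) ` {D. ktuple_dominating V adj k D}"
  assume L: "?L = enat m"
  then have "?S \<noteq> {}"
    by (auto simp: ktuple_dom_number_def Inf_enat_def split: if_splits)
  then have "Inf ?S \<in> ?S"
    unfolding Inf_enat_def by (auto intro: LeastI)
  moreover have "Inf ?S \<le> x" if "x \<in> ?S" for x
    using that by (rule Inf_lower)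
  ultimately show ?R
    using L by (fastforce simp: ktuple_dom_number_def)
next
  assume ?R
  then show "?L = enat m"
    unfolding ktuple_dom_number_def
    by (intro antisym INF_greatest) (auto intro: INF_lower2)
qed

definition kneser2_verts :: "nat \<Rightarrow> nat set set" where
  "kneser2_verts n = {A. A \<subseteq> {1..n} \<and> card A = 2}"

definition kneser2_adj :: "nat set \<Rightarrow> nat set \<Rightarrow> bool" where
  "kneser2_adj A B \<longleftrightarrow> A \<inter> B = {}"

abbreviation gamma_times_kneser2 :: "nat \<Rightarrow> nat \<Rightarrow> enat" where
  "gamma_times_kneser2 k n \<equiv> ktuple_dom_number (kneser2_verts n) kneser2_adj k"

end

theory Submission
  imports Defs
begin

text \<open>
  View a set \<open>D\<close> of vertices of \<open>K(n,2)\<close> as the edge set of a graph on \<open>{1..n}\<close>. Counting the edges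
  that meet \<open>{a, b}\<close> shows that \<open>D\<close> is \<open>k\<close>-tuple dominating iff
  \<open>k + deg a + deg b \<le> |D| + 2[{a, b} \<in> D]\<close> for all \<open>a \<noteq> b\<close>. If \<open>|D| = k + t\<close> with \<open>1 \<le> t \<le> 3\<close>, a vertex
  of degree \<open>d \<ge> t\<close> forces all its non-neighbours to be isolated and its neighbours to have degree
  at most \<open>t + 2 - d\<close>, which leaves too few edges; so all degrees are less than \<open>t\<close>. For \<open>t = 2\<close> the
  graph is a matching, so \<open>n \<ge> 2k + 4\<close>. For \<open>t = 3\<close> the vertices of degree 2 are pairwise adjacent,
  so there are at most three of them and \<open>2(k + 3) \<le> n + 3\<close>. A matching attains the
  first bound, a triangle together with a matching attains the second.
\<close>

section \<open>Domination as a degree condition on the graph with edge set \<open>D\<close>\<close>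

definition edge_deg :: "'a set set \<Rightarrow> 'a \<Rightarrow> nat" where
  "edge_deg D a = card {e \<in> D. a \<in> e}"

definition edge_nbrs :: "'a set set \<Rightarrow> 'a \<Rightarrow> 'a set" where
  "edge_nbrs D a = {b. b \<noteq> a \<and> {a, b} \<in> D}"

lemma finite_kneser2_verts [simp]: "finite (kneser2_verts n)"
  unfolding kneser2_verts_def by (rule finite_subset[of _ "Pow {1..n}"]) auto

lemma finite_subset_kneser2_verts: "D \<subseteq> kneser2_verts n \<Longrightarrow> finite D"
  by (erule finite_subset) simp

lemma insert2_in_kneser2_verts_iff:
  assumes "a \<noteq> b"
  shows "{a, b} \<in> kneser2_verts n \<longleftrightarrow> a \<in> {1..n} \<and> b \<in> {1..n}"
  using assms by (auto simp: kneser2_verts_def)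

lemma in_kneser2_vertsE:
  assumes "v \<in> kneser2_verts n"
  obtains a b where "v = {a, b}" "a \<noteq> b" "a \<in> {1..n}" "b \<in> {1..n}"
  using assms by (auto simp: kneser2_verts_def card_2_iff)

text \<open>Inclusion-exclusion. The edges of \<open>D\<close> avoiding both \<open>a\<close> and
  \<open>b\<close> lie in the neighbourhood. If \<open>{a, b}\<close> is an edge, it contributes
  twice to the degree sum and once more as the centre of the closed neighbourhood: three counts
  against one in \<open>card D\<close>, hence the surplus 2.\<close>

lemma card_closed_nbhd_kneser2:
  assumes D: "D \<subseteq> kneser2_verts n" and "a \<noteq> b"
  shows "card (closed_nbhd (kneser2_verts n) kneser2_adj {a, b} \<inter> D) + edge_deg D a + edge_deg D b
    = card D + (if {a, b} \<in> D then 2 else 0)"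
proof -
  have fin: "finite D"
    using D by (rule finite_subset_kneser2_verts)
  define A where "A = {e \<in> D. a \<in> e}"
  define B where "B = {e \<in> D. b \<in> e}"
  define C where "C = {e \<in> D. {a, b} \<inter> e = {}}"
  define E where "E = {e \<in> D. e = {a, b}}"
  have "e = {a, b}" if "e \<in> D" "a \<in> e" "b \<in> e" for e
    using that D \<open>a \<noteq> b\<close> by (auto elim!: in_kneser2_vertsE dest!: subsetD)
  then have AB: "A \<inter> B = E"
    by (auto simp: A_def B_def E_def)
  have [simp]: "finite A" "finite B" "finite C" "finite E"
    using fin by (auto simp: A_def B_def C_def E_def)
  have "card A + card B = card (A \<union> B) + card E"
    using card_Un_Int[of A B] AB by simp
  moreover have "card D = card (A \<union> B) + card C"
  proof -
    have "D = (A \<union> B) \<union> C" "(A \<union> B) \<inter> C = {}"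
      by (auto simp: A_def B_def C_def)
    then show ?thesis
      by (metis \<open>finite A\<close> \<open>finite B\<close> \<open>finite C\<close> card_Un_disjoint finite_UnI)
  qed
  moreover have "card (closed_nbhd (kneser2_verts n) kneser2_adj {a, b} \<inter> D) = card C + card E"
  proof -
    have "closed_nbhd (kneser2_verts n) kneser2_adj {a, b} \<inter> D = C \<union> E"
      using D by (auto simp: closed_nbhd_def kneser2_adj_def C_def E_def)
    moreover have "C \<inter> E = {}"
      by (auto simp: C_def E_def)
    ultimately show ?thesis
      by (simp add: card_Un_disjoint)
  qed
  moreover have "card E = (if {a, b} \<in> D then 1 else 0)"
  proof (cases "{a, b} \<in> D")
    case True
    then have "E = {{a, b}}"
      by (auto simp: E_def)
    with True show ?thesis
      by simp
  qed (auto simp: E_def)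
  ultimately show ?thesis
    by (auto simp: edge_deg_def A_def B_def)
qed

lemma ktuple_dominating_kneser2_iff:
  "ktuple_dominating (kneser2_verts n) kneser2_adj k D \<longleftrightarrow>
    D \<subseteq> kneser2_verts n \<and>
    (\<forall>a\<in>{1..n}. \<forall>b\<in>{1..n}. a \<noteq> b \<longrightarrow>
      k + edge_deg D a + edge_deg D b \<le> card D + (if {a, b} \<in> D then 2 else 0))"
    (is "?L \<longleftrightarrow> ?S \<and> ?R")
proof (cases ?S)
  case True
  have "?L \<longleftrightarrow> (\<forall>a\<in>{1..n}. \<forall>b\<in>{1..n}. a \<noteq> b \<longrightarrow>
      k \<le> card (closed_nbhd (kneser2_verts n) kneser2_adj {a, b} \<inter> D))"
    unfolding ktuple_dominating_def using True
    by (metis in_kneser2_vertsE insert2_in_kneser2_verts_iff)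
  also have "\<dots> \<longleftrightarrow> ?R"
  proof (intro ball_cong refl imp_cong)
    fix a b :: nat
    assume "a \<noteq> b"
    then show "k \<le> card (closed_nbhd (kneser2_verts n) kneser2_adj {a, b} \<inter> D) \<longleftrightarrow>
        k + edge_deg D a + edge_deg D b \<le> card D + (if {a, b} \<in> D then 2 else 0)"
      using card_closed_nbhd_kneser2[OF True, of a b] by linarith
  qed
  finally show ?thesis
    using True by simp
qed (simp add: ktuple_dominating_def)

lemma ktuple_dominating_kneser2D:
  assumes "ktuple_dominating (kneser2_verts n) kneser2_adj k D"
    and "a \<in> {1..n}" "b \<in> {1..n}" "a \<noteq> b"
  shows "k + edge_deg D a + edge_deg D b \<le> card D + (if {a, b} \<in> D then 2 else 0)"
  using assms unfolding ktuple_dominating_kneser2_iff by blast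

text \<open>Serves to pad a small dominating set to exactly \<open>k + 2\<close> elements, a size
  that the degree argument can handle.\<close>

lemma ktuple_dominating_mono:
  assumes "ktuple_dominating V adj k D" "D \<subseteq> D'" "D' \<subseteq> V" "finite V"
  shows "ktuple_dominating V adj k D'"
proof -
  have "card (closed_nbhd V adj v \<inter> D) \<le> card (closed_nbhd V adj v \<inter> D')" for v
    using assms by (intro card_mono) (auto intro: finite_subset)
  then show ?thesis
    using assms unfolding ktuple_dominating_def by (meson le_trans)
qed

text \<open>Handshake lemma, by counting incident pairs of a point and an edge in two ways.\<close>

lemma sum_edge_deg_kneser2:
  assumes "D \<subseteq> kneser2_verts n"
  shows "(\<Sum>a\<in>{1..n}. edge_deg D a) = 2 * card D"
proof -
  have fin: "finite D"
    using assms by (rule finite_subset_kneser2_verts)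
  have "(\<Sum>a\<in>{1..n}. edge_deg D a) = (\<Sum>e\<in>D. card {a \<in> {1..n}. a \<in> e})"
    unfolding edge_deg_def card_eq_sum using fin by (intro sum.swap_restrict) auto
  also have "\<dots> = (\<Sum>e\<in>D. 2)"
  proof (rule sum.cong[OF refl])
    fix e
    assume "e \<in> D"
    then have "e \<subseteq> {1..n}" "card e = 2"
      using assms by (auto simp: kneser2_verts_def)
    moreover from this have "{a \<in> {1..n}. a \<in> e} = e"
      by auto
    ultimately show "card {a \<in> {1..n}. a \<in> e} = 2"
      by simp
  qed
  finally show ?thesis
    by simp
qed

lemma card_edge_nbrs_kneser2:
  assumes "D \<subseteq> kneser2_verts n"
  shows "card (edge_nbrs D a) = edge_deg D a"
proof -
  have "bij_betw (\<lambda>b. {a, b}) (edge_nbrs D a) {e \<in> D. a \<in> e}"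
  proof (rule bij_betw_imageI)
    show "inj_on (\<lambda>b. {a, b}) (edge_nbrs D a)"
      by (auto simp: inj_on_def doubleton_eq_iff)
    have "e \<in> (\<lambda>b. {a, b}) ` edge_nbrs D a" if "e \<in> D" "a \<in> e" for e
    proof -
      obtain c d where "e = {c, d}" "c \<noteq> d"
        using assms \<open>e \<in> D\<close> by (meson in_kneser2_vertsE subsetD)
      then show ?thesis
        using that by (auto simp: edge_nbrs_def insert_commute)
    qed
    then show "(\<lambda>b. {a, b}) ` edge_nbrs D a = {e \<in> D. a \<in> e}"
      by (auto simp: edge_nbrs_def)
  qed
  then show ?thesis
    unfolding edge_deg_def by (rule bij_betw_same_card)
qed

lemma edge_nbrs_subset:
  assumes "D \<subseteq> kneser2_verts n"
  shows "edge_nbrs D a \<subseteq> {1..n} - {a}"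
  using assms insert2_in_kneser2_verts_iff by (auto simp: edge_nbrs_def)

lemma edge_deg_pos_if_edge:
  assumes "D \<subseteq> kneser2_verts n" "{a, b} \<in> D"
  shows "edge_deg D b \<ge> 1"
proof -
  have "finite D"
    using assms(1) by (rule finite_subset_kneser2_verts)
  then have "{e \<in> D. b \<in> e} \<noteq> {}" "finite {e \<in> D. b \<in> e}"
    using assms(2) by auto
  then show ?thesis
    unfolding edge_deg_def by (simp add: Suc_le_eq card_gt_0_iff)
qed

section \<open>Degree bounds and the resulting lower bounds on \<open>n\<close>\<close>

lemma edge_deg_less:
  assumes dom: "ktuple_dominating (kneser2_verts n) kneser2_adj k D"
    and card: "card D = k + t" and t: "1 \<le> t" "t \<le> 3" and k: "k \<ge> 2" and a: "a \<in> {1..n}"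
  shows "edge_deg D a < t"
proof (rule ccontr)
  define d where "d = edge_deg D a"
  assume "\<not> edge_deg D a < t"
  then have d: "t \<le> d"
    by (simp add: d_def)
  have D: "D \<subseteq> kneser2_verts n"
    using dom by (simp add: ktuple_dominating_def)
  have bound: "d + edge_deg D b \<le> t + (if {a, b} \<in> D then 2 else 0)" if "b \<in> {1..n}" "b \<noteq> a" for b
    using ktuple_dominating_kneser2D[OF dom a that(1)] that(2) card by (simp add: d_def)
  have nonadj: "edge_deg D b = 0" if "b \<in> {1..n} - {a} - edge_nbrs D a" for b
    using that bound[of b] d by (auto simp: edge_nbrs_def)
  have nbr: "edge_deg D b \<le> t + 2 - d" if "b \<in> edge_nbrs D a" for b
    using that bound[of b] edge_nbrs_subset[OF D, of a] by (force simp: edge_nbrs_def)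
  \<comment> \<open>Since \<open>d \<ge> t \<ge> 1\<close>, there is a neighbour. It has degree at
    least 1 and at most \<open>t + 2 - d\<close>, which caps \<open>d\<close> at
    \<open>t + 1\<close>.\<close>
  have "edge_nbrs D a \<noteq> {}"
    using card_edge_nbrs_kneser2[OF D, of a] d t by (auto simp: d_def)
  then obtain b where b: "b \<in> edge_nbrs D a"
    by auto
  then have "d \<le> t + 1"
    using edge_deg_pos_if_edge[OF D, of a b] nbr[OF b] by (auto simp: edge_nbrs_def)
  have "2 * (k + t) = (\<Sum>b\<in>{1..n}. edge_deg D b)"
    using sum_edge_deg_kneser2[OF D] card by simp
  also have "\<dots> = d + (\<Sum>b\<in>{1..n} - {a}. edge_deg D b)"
    using a by (simp add: sum.remove d_def)
  \<comment> \<open>Non-neighbours are isolated, so the sum reduces to the \<open>d\<close>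
    neighbours of \<open>a\<close>.\<close>
  also have "(\<Sum>b\<in>{1..n} - {a}. edge_deg D b) = (\<Sum>b\<in>edge_nbrs D a. edge_deg D b)"
    using nonadj edge_nbrs_subset[OF D, of a] by (intro sum.mono_neutral_right) auto
  also have "\<dots> \<le> d * (t + 2 - d)"
    using sum_bounded_above[of "edge_nbrs D a" "edge_deg D" "t + 2 - d"] nbr
    by (simp add: card_edge_nbrs_kneser2[OF D] d_def)
  finally have le: "2 * (k + t) \<le> d + d * (t + 2 - d)"
    by simp
  \<comment> \<open>The bound \<open>le\<close> reads \<open>2 * (k + t) \<le> 3 * t\<close> in the
    first case and \<open>2 * (k + t) \<le> 2 * (t + 1)\<close> in the second. So
    \<open>2 * k \<le> t \<le> 3\<close> or \<open>k \<le> 1\<close>, against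
    \<open>k \<ge> 2\<close>.\<close>
  consider "d = t" | "d = t + 1"
    using d \<open>d \<le> t + 1\<close> by linarith
  then show False
  proof cases
    case 1
    then show False
      using le t k by simp
  next
    case 2
    then show False
      using le k by simp
  qed
qed

text \<open>Excludes size \<open>k + 2\<close> when \<open>n = 2 * k + 3\<close>: all degrees are at
  most 1, so the handshake sum is at most \<open>n\<close>.\<close>

lemma ktuple_dominating_card_add2:
  assumes dom: "ktuple_dominating (kneser2_verts n) kneser2_adj k D"
    and card: "card D = k + 2" and "k \<ge> 2"
  shows "2 * k + 4 \<le> n"
proof -
  have "D \<subseteq> kneser2_verts n"
    using dom by (simp add: ktuple_dominating_def)
  then have "2 * (k + 2) = (\<Sum>b\<in>{1..n}. edge_deg D b)"
    using sum_edge_deg_kneser2 card by simp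
  also have "\<dots> \<le> (\<Sum>b\<in>{1..n}. 1)"
    using edge_deg_less[OF dom card] \<open>k \<ge> 2\<close> by (intro sum_mono) force
  finally show ?thesis
    by simp
qed

lemma ktuple_dominating_card_add3:
  assumes dom: "ktuple_dominating (kneser2_verts n) kneser2_adj k D"
    and card: "card D = k + 3" and "k \<ge> 2"
  shows "2 * k + 3 \<le> n"
proof -
  have D: "D \<subseteq> kneser2_verts n"
    using dom by (simp add: ktuple_dominating_def)
  define T where "T = {a \<in> {1..n}. edge_deg D a = 2}"
  have "card T \<le> 3"
  proof (cases "T = {}")
    case False
    then obtain a where a: "a \<in> T"
      by auto
    \<comment> \<open>Two non-adjacent vertices of degree 2 would give
      \<open>k + 4 \<le> k + 3\<close>. Hence \<open>T\<close> lies in the closed neighbourhood of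
      any of its members, which has 1 + 2 points.\<close>
    have "b \<in> insert a (edge_nbrs D a)" if "b \<in> T" for b
    proof (rule ccontr)
      assume "\<not> ?thesis"
      then have "b \<noteq> a" "{a, b} \<notin> D"
        by (auto simp: edge_nbrs_def)
      then show False
        using ktuple_dominating_kneser2D[OF dom, of a b] a that card by (simp add: T_def)
    qed
    moreover have "card (insert a (edge_nbrs D a)) \<le> 3"
      using a card_insert_le_m1[of 3 "edge_nbrs D a" a] card_edge_nbrs_kneser2[OF D, of a]
      by (simp add: T_def)
    moreover have "finite (edge_nbrs D a)"
      using edge_nbrs_subset[OF D] finite_subset by blast
    ultimately show ?thesis
      by (meson card_mono finite_insert le_trans subsetI)
  qed simp
  have "2 * (k + 3) = (\<Sum>b\<in>{1..n}. edge_deg D b)"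
    using sum_edge_deg_kneser2[OF D] card by simp
  \<comment> \<open>By \<open>edge_deg_less\<close> with \<open>t = 3\<close>, degrees are at most
    2, and exactly the points of \<open>T\<close> reach 2.\<close>
  also have "\<dots> \<le> (\<Sum>b\<in>{1..n}. 1 + (if b \<in> T then 1 else 0))"
  proof (rule sum_mono)
    fix b
    assume "b \<in> {1..n}"
    then show "edge_deg D b \<le> 1 + (if b \<in> T then 1 else 0)"
      using edge_deg_less[OF dom card _ _ \<open>k \<ge> 2\<close>, of b] by (auto simp: T_def)
  qed
  also have "\<dots> = n + card T"
  proof -
    have "{1..n} \<inter> T = T"
      by (auto simp: T_def)
    then show ?thesis
      unfolding sum.distrib by (simp add: sum.If_cases)
  qed
  finally show ?thesis
    using \<open>card T \<le> 3\<close> by simp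
qed

section \<open>Extremal constructions\<close>

text \<open>The offset \<open>c\<close> keeps the points up to \<open>c\<close> uncovered:
  \<open>c = 0\<close> gives the plain matching, \<open>c = 3\<close> leaves room for a triangle on
  1, 2, 3.\<close>

definition shifted_matching :: "nat \<Rightarrow> nat \<Rightarrow> nat set set" where
  "shifted_matching c p = (\<lambda>i. {c + 2 * i + 1, c + 2 * i + 2}) ` {..<p}"

lemma card_shifted_matching [simp]: "card (shifted_matching c p) = p"
proof -
  have "inj_on (\<lambda>i. {c + 2 * i + 1, c + 2 * i + 2}) {..<p}"
    by (auto simp: inj_on_def doubleton_eq_iff)
  then show ?thesis
    by (simp add: shifted_matching_def card_image)
qed

lemma shifted_matching_subset:
  assumes "c + 2 * p \<le> n"
  shows "shifted_matching c p \<subseteq> kneser2_verts n"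
  using assms by (auto simp: shifted_matching_def kneser2_verts_def)

lemma edge_deg_shifted_matching_le: "edge_deg (shifted_matching c p) a \<le> 1"
proof -
  have "e = e'" if e: "e \<in> shifted_matching c p" "e' \<in> shifted_matching c p" "a \<in> e" "a \<in> e'" for e e'
  proof -
    obtain i j where "e = {c + 2 * i + 1, c + 2 * i + 2}" "e' = {c + 2 * j + 1, c + 2 * j + 2}"
      using e(1,2) unfolding shifted_matching_def by blast
    \<comment> \<open>The pairs of consecutive numbers are disjoint for different indices, so the
      common point \<open>a\<close> determines the index.\<close>
    moreover from this have "i = j"
      using \<open>a \<in> e\<close> \<open>a \<in> e'\<close> by auto
    ultimately show ?thesis
      by simp
  qed
  then show ?thesis
    unfolding edge_deg_def
    by (simp add: card_le_Suc0_iff_eq shifted_matching_def)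
qed

lemma edge_deg_shifted_matching_eq_0:
  assumes "a \<le> c"
  shows "edge_deg (shifted_matching c p) a = 0"
proof -
  have "{e \<in> shifted_matching c p. a \<in> e} = {}"
    using assms by (auto simp: shifted_matching_def)
  then show ?thesis
    unfolding edge_deg_def by (simp only: card.empty)
qed

text \<open>Two degrees of at most 1 sum to at most 2, the excess of the size over
  \<open>k\<close>.\<close>

lemma ktuple_dominating_matching:
  assumes "2 * k + 4 \<le> n"
  shows "ktuple_dominating (kneser2_verts n) kneser2_adj k (shifted_matching 0 (k + 2))"
proof -
  have "k + edge_deg (shifted_matching 0 (k + 2)) a + edge_deg (shifted_matching 0 (k + 2)) b \<le> k + 2"
    for a b
    using edge_deg_shifted_matching_le[of 0 "k + 2" a] edge_deg_shifted_matching_le[of 0 "k + 2" b]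
    by linarith
  moreover have "shifted_matching 0 (k + 2) \<subseteq> kneser2_verts n"
    using assms by (intro shifted_matching_subset) simp
  ultimately show ?thesis
    unfolding ktuple_dominating_kneser2_iff card_shifted_matching by (blast intro: trans_le_add1)
qed

text \<open>Triangle vertices have degree 2 and all other points degree at most 1. The only pairs
  with degree sum 4 are the triangle edges, where the surplus 2 raises the right-hand side to
  \<open>k + 5\<close>; every other pair has sum at most 3.\<close>

lemma ktuple_dominating_triangle_matching:
  assumes n: "2 * k + 3 \<le> n"
  defines "D \<equiv> {{1, 2}, {1, 3}, {2, 3}} \<union> shifted_matching 3 k"
  shows "ktuple_dominating (kneser2_verts n) kneser2_adj k D" and "card D = k + 3"
proof -
  define T :: "nat set set" where "T = {{1, 2}, {1, 3}, {2, 3}}"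
  have D: "D = T \<union> shifted_matching 3 k"
    by (simp add: D_def T_def)
  have "T \<inter> shifted_matching 3 k = {}"
    by (auto simp: T_def shifted_matching_def doubleton_eq_iff)
  moreover have "card T = 3"
    by (simp add: T_def doubleton_eq_iff)
  moreover have "finite T" "finite (shifted_matching 3 k)"
    by (simp_all add: T_def shifted_matching_def)
  ultimately show card: "card D = k + 3"
    by (simp add: D card_Un_disjoint)
  have sub: "D \<subseteq> kneser2_verts n"
    using n shifted_matching_subset[of 3 k n] by (auto simp: D T_def kneser2_verts_def)
  have deg: "edge_deg D a \<le> edge_deg T a + edge_deg (shifted_matching 3 k) a" for a
  proof -
    have "{e \<in> D. a \<in> e} = {e \<in> T. a \<in> e} \<union> {e \<in> shifted_matching 3 k. a \<in> e}"
      by (auto simp: D)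
    then show ?thesis
      unfolding edge_deg_def by (metis card_Un_le)
  qed
  have deg_le: "edge_deg D a \<le> (if a \<le> 3 then 2 else 1)" if "a \<ge> 1" for a
  proof (cases "a \<le> 3")
    case True
    then have "a = 1 \<or> a = 2 \<or> a = 3"
      using that by auto
    \<comment> \<open>The triangle edge opposite to \<open>a\<close> avoids it, so at most two of
      the three edges contain \<open>a\<close>. The matching starts at 4 and adds nothing
      here.\<close>
    then have "\<exists>e\<in>T. a \<notin> e"
      by (auto simp: T_def)
    then have "{e \<in> T. a \<in> e} \<subset> T"
      by blast
    then have "edge_deg T a < card T"
      unfolding edge_deg_def using \<open>finite T\<close> by (intro psubset_card_mono)
    then have "edge_deg T a \<le> 2"
      using \<open>card T = 3\<close> by simp
    then show ?thesis
      using True deg[of a] edge_deg_shifted_matching_eq_0[of a 3 k] by simp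
  next
    case False
    then have "{e \<in> T. a \<in> e} = {}"
      by (auto simp: T_def)
    then have "edge_deg T a = 0"
      unfolding edge_deg_def by (simp only: card.empty)
    then show ?thesis
      using False deg[of a] edge_deg_shifted_matching_le[of 3 k a] by simp
  qed
  have "k + edge_deg D a + edge_deg D b \<le> card D + (if {a, b} \<in> D then 2 else 0)"
    if "a \<in> {1..n}" "b \<in> {1..n}" "a \<noteq> b" for a b
  proof (cases "a \<le> 3 \<and> b \<le> 3")
    case True
    then have "a = 1 \<or> a = 2 \<or> a = 3" "b = 1 \<or> b = 2 \<or> b = 3"
      using that by auto
    then have "{a, b} \<in> D"
      using \<open>a \<noteq> b\<close> by (auto simp: D T_def)
    then show ?thesis
      using that True deg_le[of a] deg_le[of b] card by simp
  next
    case False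
    then show ?thesis
      using that deg_le[of a] deg_le[of b] card by (auto split: if_splits)
  qed
  then show "ktuple_dominating (kneser2_verts n) kneser2_adj k D"
    using sub by (simp add: ktuple_dominating_kneser2_iff)
qed

theorem theorem20:
  fixes k n :: nat
  assumes "k \<ge> 2" and "n \<ge> 5"
  shows "gamma_times_kneser2 k n = enat (k + 3) \<longleftrightarrow> n = 2 * k + 3"
proof
  assume "gamma_times_kneser2 k n = enat (k + 3)"
  then obtain D where D: "ktuple_dominating (kneser2_verts n) kneser2_adj k D" "card D = k + 3"
    and min: "\<And>D. ktuple_dominating (kneser2_verts n) kneser2_adj k D \<Longrightarrow> k + 3 \<le> card D"
    unfolding ktuple_dom_number_eq_enat_iff by blast
  have "2 * k + 3 \<le> n"
    using ktuple_dominating_card_add3[OF D \<open>k \<ge> 2\<close>] .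
  \<comment> \<open>Otherwise the matching would be a dominating set of size \<open>k + 2\<close>,
    below the minimum.\<close>
  moreover have "\<not> 2 * k + 4 \<le> n"
    using min[OF ktuple_dominating_matching] by auto
  ultimately show "n = 2 * k + 3"
    by linarith
next
  assume n: "n = 2 * k + 3"
  obtain D where D: "ktuple_dominating (kneser2_verts n) kneser2_adj k D" "card D = k + 3"
    using ktuple_dominating_triangle_matching[of k n] n by auto
  have "k + 3 \<le> card D'" if D': "ktuple_dominating (kneser2_verts n) kneser2_adj k D'" for D'
  proof (rule ccontr)
    assume "\<not> k + 3 \<le> card D'"
    then have "card D' \<le> k + 2"
      by simp
    \<comment> \<open>There are enough vertices to enlarge \<open>D'\<close> to size exactly
      \<open>k + 2\<close>, because \<open>D\<close> already has \<open>k + 3\<close>. The enlarged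
      set still dominates and would force \<open>n \<ge> 2 * k + 4\<close>.\<close>
    moreover have "k + 2 \<le> card (kneser2_verts n)"
      using D card_mono[OF finite_kneser2_verts, of D n] by (simp add: ktuple_dominating_def)
    moreover have "D' \<subseteq> kneser2_verts n"
      using D' by (simp add: ktuple_dominating_def)
    ultimately obtain E where "D' \<subseteq> E" "E \<subseteq> kneser2_verts n" "card E = k + 2"
      using exists_subset_between[of D' "k + 2" "kneser2_verts n"] by auto
    then show False
      using ktuple_dominating_card_add2[of n k E] ktuple_dominating_mono[OF D', of E] n \<open>k \<ge> 2\<close>
      by simp
  qed
  with D show "gamma_times_kneser2 k n = enat (k + 3)"
    unfolding ktuple_dom_number_eq_enat_iff by blast
qed

end
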